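(* Let $G=(V,E,\mu)$ be a finite weighted digraph with strictly positive resistances $\mu_e$, let $r>0$ and $s>0$ be real parameters, and let $a,b\in V$ be distinct nodes. Then the effective resistance from $a$ to $b$ is well defined, in the following sense. For all reals $x_a^0\ge x_b^0$ the two-pole circuit $(G,a,b)$ with boundary potentials $x_a=x_a^0$, $x_b=x_b^0$ has a solution, and the total current $y_{a,b}^*$ from $a$ to $b$ is the same for all solutions. If $G$ contains a directed path from $a$ to $b$, then there is a unique real number $\mu_{a,b}>0$ (independent of the boundary potentials) such that, for all $x_a^0\ge x_b^0$, with $y_{a,b}=x_a^0-x_b^0$, $$y_{a,b}^*=\frac{y_{a,b}^r}{\mu_{a,b}^s}.$$ If $G$ contains no directed path from $a$ to $b$, then $y_{a,b}^*=0$ for all $x_a^0\ge x_b^0$.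
   Context: Circuit. $G=(V,E,\mu)$ is a finite digraph (parallel edges allowed), each directed edge $e$ having a resistance $\mu_e>0$; $r,s>0$ are real parameters common to all edges. A potential vector $x=(x_v)_{v\in V}\in\mathbb{R}^V$ determines: - voltages $y_e=x_{v'}-x_{v''}$ for each directed edge $e=(v',v'')$ (from $v'$ to $v''$); - currents $y_e^*=y_e^r/\mu_e^s$ if $y_e\ge 0$, and $y_e^*=0$ if $y_e\le 0$; - fluxes $x_v^*=\sum_{e \text{ begins at } v}y_e^*-\sum_{e\text{ ends at }v}y_e^*$ for $v\in V$. Solution of a two-pole circuit. For distinct nodes $a,b$ and reals $x_a^0\ge x_b^0$, a solution of $(G,a,b)$ is a potential vector $x$ with $x_a=x_a^0$, $x_b=x_b^0$, and $x_v^*=0$ (first Kirchhoff law) for all $v\in V\setminus\{a,b\}$. The total current from $a$ to $b$ in a solution is $y_{a,b}^*=x_a^*=-x_b^*$. *)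

theory Defs
  imports Complex_Main "Graph_Theory.Digraph" "Graph_Theory.Arc_Walk"
begin

text \<open>A potential vector is a function on the vertex type; only its values on
  \<^term>\<open>verts G\<close> matter below.\<close>

definition voltage :: "('a, 'b) pre_digraph \<Rightarrow> ('a \<Rightarrow> real) \<Rightarrow> 'b \<Rightarrow> real" where
  "voltage G x e = x (tail G e) - x (head G e)"

text \<open>The value at voltage \<open>0\<close> is \<open>0\<close>, since \<^term>\<open>(0::real) powr r = 0\<close>.\<close>

definition current ::
  "('a, 'b) pre_digraph \<Rightarrow> ('b \<Rightarrow> real) \<Rightarrow> real \<Rightarrow> real \<Rightarrow> ('a \<Rightarrow> real) \<Rightarrow> 'b \<Rightarrow> real" where
  "current G \<mu> r s x e =
     (if voltage G x e \<ge> 0 then voltage G x e powr r / \<mu> e powr s else 0)"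

definition flux ::
  "('a, 'b) pre_digraph \<Rightarrow> ('b \<Rightarrow> real) \<Rightarrow> real \<Rightarrow> real \<Rightarrow> ('a \<Rightarrow> real) \<Rightarrow> 'a \<Rightarrow> real" where
  "flux G \<mu> r s x v =
     (\<Sum>e\<in>out_arcs G v. current G \<mu> r s x e) - (\<Sum>e\<in>in_arcs G v. current G \<mu> r s x e)"

definition two_pole_solution ::
  "('a, 'b) pre_digraph \<Rightarrow> ('b \<Rightarrow> real) \<Rightarrow> real \<Rightarrow> real \<Rightarrow> 'a \<Rightarrow> 'a \<Rightarrow> real \<Rightarrow> real \<Rightarrow>
     ('a \<Rightarrow> real) \<Rightarrow> bool" where
  "two_pole_solution G \<mu> r s a b xa xb x \<longleftrightarrow>
     x a = xa \<and> x b = xb \<and> (\<forall>v \<in> verts G - {a, b}. flux G \<mu> r s x v = 0)"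

text \<open>The total current between the poles is the flux at the pole \<open>a\<close>; in a solution it is
  also the negated flux at \<open>b\<close>, by \<open>total_current_eq_minus_flux\<close> below.\<close>

definition total_current ::
  "('a, 'b) pre_digraph \<Rightarrow> ('b \<Rightarrow> real) \<Rightarrow> real \<Rightarrow> real \<Rightarrow> 'a \<Rightarrow> ('a \<Rightarrow> real) \<Rightarrow> real" where
  "total_current G \<mu> r s a x = flux G \<mu> r s x a"

lemma sum_flux_eq_0:
  assumes "fin_digraph G"
  shows "(\<Sum>v\<in>verts G. flux G \<mu> r s x v) = 0"
proof -
  interpret fin_digraph G by fact
  have o: "(\<Sum>v\<in>verts G. \<Sum>e\<in>out_arcs G v. current G \<mu> r s x e) = (\<Sum>e\<in>arcs G. current G \<mu> r s x e)"
    unfolding out_arcs_def by (rule sum.group) auto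
  have i: "(\<Sum>v\<in>verts G. \<Sum>e\<in>in_arcs G v. current G \<mu> r s x e) = (\<Sum>e\<in>arcs G. current G \<mu> r s x e)"
    unfolding in_arcs_def by (rule sum.group) auto
  show ?thesis
    unfolding flux_def sum_subtractf o i by simp
qed

lemma total_current_eq_minus_flux:
  assumes "fin_digraph G" "a \<in> verts G" "b \<in> verts G" "a \<noteq> b"
    and "two_pole_solution G \<mu> r s a b xa xb x"
  shows "total_current G \<mu> r s a x = - flux G \<mu> r s x b"
proof -
  interpret fin_digraph G by fact
  have "(\<Sum>v\<in>verts G. flux G \<mu> r s x v) = (\<Sum>v\<in>{a, b}. flux G \<mu> r s x v)"
    using assms by (intro sum.mono_neutral_right) (auto simp: two_pole_solution_def)
  then show ?thesis
    using sum_flux_eq_0[OF assms(1), of \<mu> r s x] \<open>a \<noteq> b\<close> by (simp add: total_current_def)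
qed

end

(* The flux at v is continuous in x_v and decreasing in the other potentials, so the pointwise
   supremum of the potentials with nonpositive interior fluxes is a solution (Perron's method).
   For potentials f and x, the sum of f_v x_v^* over nodes equals the sum of (f_v' - f_v'') y_e^*
   over edges. With f the difference of two solutions, and the currents replaced by their
   differences, monotonicity of y_e^* in y_e forces the currents to agree; with f = x, it shows that
   the total current is positive as soon as some voltage is. Homogeneity of degree r then gives the
   power law. *)
theory Submission
  imports Defs
begin

locale circuit = fin_digraph G
  for G :: "('a, 'b) pre_digraph" (structure) +
  fixes \<mu> :: "'b \<Rightarrow> real" and r s :: real
  assumes mu_pos: "e \<in> arcs G \<Longrightarrow> \<mu> e > 0"
    and r_pos: "r > 0"
begin

section \<open>Monotonicity and continuity of currents and fluxes\<close>

lemma current_eq_max: "current G \<mu> r s x e = (max 0 (voltage G x e)) powr r / \<mu> e powr s"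
  by (auto simp: current_def max_def)

lemma current_nonneg: "current G \<mu> r s x e \<ge> 0"
  by (simp add: current_def)

lemma current_eq_0: "voltage G x e \<le> 0 \<Longrightarrow> current G \<mu> r s x e = 0"
  by (simp add: current_def)

lemma current_pos:
  assumes "e \<in> arcs G" "voltage G x e > 0"
  shows "current G \<mu> r s x e > 0"
  using assms mu_pos[of e] by (simp add: current_def)

lemma current_mono:
  assumes "voltage G x e \<le> voltage G x' e"
  shows "current G \<mu> r s x e \<le> current G \<mu> r s x' e"
  unfolding current_eq_max using assms r_pos
  by (intro divide_right_mono powr_mono2) auto

lemma continuous_current:
  assumes "continuous_on UNIV (\<lambda>t. voltage G (f t) e)"
  shows "continuous_on UNIV (\<lambda>t. current G \<mu> r s (f t) e)"
proof -
  have "continuous_on UNIV (\<lambda>t. max 0 (voltage G (f t) e) powr r)"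
    \<comment> \<open>Continuity where the base reaches 0 relies on the exponent \<open>r\<close>
      being positive.\<close>
    using r_pos by (intro continuous_on_powr' continuous_intros assms) auto
  then show ?thesis
    unfolding current_eq_max divide_inverse by (intro continuous_on_mult continuous_on_const)
qed

lemma continuous_flux:
  fixes x :: "'a \<Rightarrow> real" and v w :: 'a
  shows "continuous_on UNIV (\<lambda>t::real. flux G \<mu> r s (x(w := t)) v)"
proof -
  have upd: "continuous_on UNIV (\<lambda>t::real. (x(w := t)) u)" for u
    by (cases "u = w") (auto intro: continuous_intros)
  show ?thesis
    unfolding flux_def
    by (intro continuous_on_diff continuous_on_sum continuous_current)
       (auto simp: voltage_def simp del: fun_upd_apply intro!: continuous_on_diff upd)
qed

text \<open>With the potential at \<open>v\<close> held fixed, raising the others lowers voltages on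
  edges leaving \<open>v\<close> and raises them on edges entering it. This is the comparison
  principle behind Perron's method.\<close>

lemma flux_antimono:
  assumes "\<And>w. x w \<le> x' w" "x v = x' v"
  shows "flux G \<mu> r s x' v \<le> flux G \<mu> r s x v"
  unfolding flux_def
proof (intro diff_mono sum_mono current_mono)
  show "voltage G x' e \<le> voltage G x e" if "e \<in> out_arcs G v" for e
    using that assms(1)[of "head G e"] assms(2) by (auto simp: voltage_def)
  show "voltage G x e \<le> voltage G x' e" if "e \<in> in_arcs G v" for e
    using that assms(1)[of "tail G e"] assms(2) by (auto simp: voltage_def)
qed

text \<open>No edge into a node of maximal potential has positive voltage, so only outgoing currents
  remain.\<close>

lemma flux_nonneg_at_max:
  assumes "\<And>w. x w \<le> x v"
  shows "flux G \<mu> r s x v \<ge> 0"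
proof -
  have "(\<Sum>e\<in>in_arcs G v. current G \<mu> r s x e) = 0"
    using assms by (intro sum.neutral ballI current_eq_0) (auto simp: voltage_def)
  then show ?thesis by (simp add: flux_def sum_nonneg current_nonneg)
qed

lemma flux_nonpos_at_min:
  assumes "\<And>w. x v \<le> x w"
  shows "flux G \<mu> r s x v \<le> 0"
proof -
  have "(\<Sum>e\<in>out_arcs G v. current G \<mu> r s x e) = 0"
    using assms by (intro sum.neutral ballI current_eq_0) (auto simp: voltage_def)
  then show ?thesis by (simp add: flux_def sum_nonneg current_nonneg)
qed

text \<open>Summation by parts: each edge current is counted once at its tail and once, negatively,
  at its head.\<close>

lemma sum_mult_flux:
  "(\<Sum>v\<in>verts G. f v * flux G \<mu> r s x v) = (\<Sum>e\<in>arcs G. voltage G f e * current G \<mu> r s x e)"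
proof -
  have "(\<Sum>v\<in>verts G. \<Sum>e\<in>out_arcs G v. f v * current G \<mu> r s x e)
      = (\<Sum>v\<in>verts G. \<Sum>e\<in>out_arcs G v. f (tail G e) * current G \<mu> r s x e)"
    by (intro sum.cong) auto
  also have "\<dots> = (\<Sum>e\<in>arcs G. f (tail G e) * current G \<mu> r s x e)"
    unfolding out_arcs_def by (rule sum.group) auto
  finally have o: "(\<Sum>v\<in>verts G. \<Sum>e\<in>out_arcs G v. f v * current G \<mu> r s x e)
      = (\<Sum>e\<in>arcs G. f (tail G e) * current G \<mu> r s x e)" .
  have "(\<Sum>v\<in>verts G. \<Sum>e\<in>in_arcs G v. f v * current G \<mu> r s x e)
      = (\<Sum>v\<in>verts G. \<Sum>e\<in>in_arcs G v. f (head G e) * current G \<mu> r s x e)"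
    by (intro sum.cong) auto
  also have "\<dots> = (\<Sum>e\<in>arcs G. f (head G e) * current G \<mu> r s x e)"
    unfolding in_arcs_def by (rule sum.group) auto
  finally have i: "(\<Sum>v\<in>verts G. \<Sum>e\<in>in_arcs G v. f v * current G \<mu> r s x e)
      = (\<Sum>e\<in>arcs G. f (head G e) * current G \<mu> r s x e)" .
  show ?thesis
    unfolding flux_def right_diff_distrib sum_distrib_left sum_subtractf o i
    by (simp add: voltage_def left_diff_distrib sum_subtractf)
qed

section \<open>Existence by Perron's method\<close>

lemma two_pole_solution_exists:
  assumes "xb \<le> xa" "a \<noteq> b"
  shows "\<exists>x. two_pole_solution G \<mu> r s a b xa xb x"
proof -
  \<comment> \<open>Subsolutions. The bounds hold at every \<open>w\<close>, so pointwise suprema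
    exist and stay between \<open>xb\<close> and \<open>xa\<close>.\<close>
  define S where "S = {x. x a = xa \<and> x b = xb \<and> (\<forall>w. xb \<le> x w \<and> x w \<le> xa) \<and>
      (\<forall>v\<in>verts G - {a, b}. flux G \<mu> r s x v \<le> 0)}"
  \<comment> \<open>Every node other than \<open>a\<close> sits at the minimum, where the flux is
    nonpositive.\<close>
  have "(\<lambda>_. xb)(a := xa) \<in> S"
    using assms by (auto simp: S_def intro!: flux_nonpos_at_min split: if_splits)
  then have ne: "S \<noteq> {}" by blast
  define y where "y w = (SUP x\<in>S. x w)" for w
  have bdd: "bdd_above ((\<lambda>x. x w) ` S)" for w
    by (rule bdd_aboveI[of _ xa]) (auto simp: S_def)
  have le_y: "x w \<le> y w" if "x \<in> S" for x w
    unfolding y_def using that bdd by (rule cSUP_upper)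
  have y_le: "y w \<le> c" if "\<And>x. x \<in> S \<Longrightarrow> x w \<le> c" for w c
    unfolding y_def using ne that by (rule cSUP_least)
  from ne obtain x0 where x0: "x0 \<in> S" by blast
  have y_upper: "y w \<le> xa" for w
    by (rule y_le) (simp add: S_def)
  have y_lower: "xb \<le> y w" for w
    using le_y[OF x0, of w] x0 order_trans by (auto simp: S_def)
  have ya: "y a = xa"
    using y_upper[of a] le_y[OF x0, of a] x0 by (simp add: S_def)
  have yb: "y b = xb"
    using y_lower[of b] y_le[of b xb] by (simp add: S_def)
  have cont: "isCont (\<lambda>t. flux G \<mu> r s (y(v := t)) v) (y v)" for v
    using continuous_flux by (simp add: continuous_on_eq_continuous_at)
  \<comment> \<open>The supremum is again a subsolution. A positive flux would stay positive after
    lowering \<open>y v\<close> to a nearby \<open>x v\<close> with \<open>x\<close> in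
    \<open>S\<close>; since \<open>x\<close> lies below \<open>y\<close> elsewhere, its own flux at
    \<open>v\<close> would be positive too.\<close>
  have y_sub: "flux G \<mu> r s y v \<le> 0" if v: "v \<in> verts G - {a, b}" for v
  proof (rule ccontr)
    assume "\<not> flux G \<mu> r s y v \<le> 0"
    then have "\<forall>\<^sub>F t in at (y v). flux G \<mu> r s (y(v := t)) v > 0"
      using cont[of v] by (intro order_tendstoD(1)) (auto simp: isCont_def)
    then obtain d where d: "d > 0"
      "\<And>t. t \<noteq> y v \<Longrightarrow> dist t (y v) < d \<Longrightarrow> flux G \<mu> r s (y(v := t)) v > 0"
      by (auto simp: eventually_at)
    have "y v - d < (SUP x\<in>S. x v)" using d(1) by (simp add: y_def)
    then obtain x where x: "x \<in> S" "y v - d < x v"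
      using less_cSUP_iff[OF ne bdd] by blast
    have "flux G \<mu> r s (y(v := x v)) v > 0"
    \<comment> \<open>The neighbourhood from \<open>eventually_at\<close> is punctured, so the
      centre is treated separately.\<close>
    proof (cases "x v = y v")
      case True
      then show ?thesis using \<open>\<not> flux G \<mu> r s y v \<le> 0\<close> by simp
    next
      case False
      then show ?thesis using d(2)[of "x v"] x le_y[OF x(1), of v] by (simp add: dist_real_def)
    qed
    moreover have "flux G \<mu> r s (y(v := x v)) v \<le> flux G \<mu> r s x v"
      using le_y[OF x(1)] by (intro flux_antimono) auto
    moreover have "flux G \<mu> r s x v \<le> 0" using x(1) v by (simp add: S_def)
    ultimately show False by simp
  qed
  \<comment> \<open>With negative flux at \<open>v\<close>, the potential there could be raised
    without leaving \<open>S\<close>, against maximality of \<open>y\<close>.\<close>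
  have "flux G \<mu> r s y v = 0" if v: "v \<in> verts G - {a, b}" for v
  proof (rule ccontr)
    assume "flux G \<mu> r s y v \<noteq> 0"
    with y_sub[OF v] have neg: "flux G \<mu> r s y v < 0" by simp
    \<comment> \<open>A node at the upper bound has nonnegative flux, so there is room to raise
      \<open>y v\<close>.\<close>
    have "y v \<noteq> xa"
      using flux_nonneg_at_max[of y v] y_upper neg by fastforce
    then have lt: "y v < xa" using y_upper[of v] by simp
    have "\<forall>\<^sub>F t in at (y v). flux G \<mu> r s (y(v := t)) v < 0"
      using cont[of v] neg by (intro order_tendstoD(2)) (auto simp: isCont_def)
    then obtain d where d: "d > 0"
      "\<And>t. t \<noteq> y v \<Longrightarrow> dist t (y v) < d \<Longrightarrow> flux G \<mu> r s (y(v := t)) v < 0"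
      by (auto simp: eventually_at)
    \<comment> \<open>The cap \<open>xa\<close> keeps the bounds of \<open>S\<close>;
      \<open>d / 2\<close> keeps \<open>t\<close> strictly within distance \<open>d\<close>.\<close>
    define t where "t = min xa (y v + d / 2)"
    have t: "y v < t" "t \<le> xa" "t < y v + d" using lt d(1) by (auto simp: t_def)
    have "y(v := t) \<in> S"
    proof -
      have "flux G \<mu> r s (y(v := t)) w \<le> 0" if w: "w \<in> verts G - {a, b}" for w
      proof (cases "w = v")
        case True
        then show ?thesis using d(2)[of t] t by (simp add: dist_real_def)
      next
        case False
        have "flux G \<mu> r s (y(v := t)) w \<le> flux G \<mu> r s y w"
          using False t by (intro flux_antimono) auto
        then show ?thesis using y_sub[OF w] by simp
      qed
      moreover have "xb \<le> t" using y_lower[of v] t(1) by linarith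
      ultimately show ?thesis using v t ya yb y_lower y_upper by (auto simp: S_def)
    qed
    from le_y[OF this, of v] t(1) show False by simp
  qed
  then have "two_pole_solution G \<mu> r s a b xa xb y"
    using ya yb by (simp add: two_pole_solution_def)
  then show ?thesis by blast
qed

section \<open>Uniqueness of the currents\<close>

lemma total_current_unique:
  assumes x: "two_pole_solution G \<mu> r s a b xa xb x"
    and x': "two_pole_solution G \<mu> r s a b xa xb x'"
  shows "total_current G \<mu> r s a x = total_current G \<mu> r s a x'"
proof -
  let ?i = "current G \<mu> r s x" and ?i' = "current G \<mu> r s x'"
  define f where "f v = x v - x' v" for v
  have volt: "voltage G f e = voltage G x e - voltage G x' e" for e
    by (simp add: voltage_def f_def)
  \<comment> \<open>At the poles \<open>f\<close> vanishes, at all other nodes both fluxes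
    do.\<close>
  have zero: "f v * flux G \<mu> r s x v = 0" "f v * flux G \<mu> r s x' v = 0" if "v \<in> verts G" for v
    using that x x' by (auto simp: two_pole_solution_def f_def)
  have "(\<Sum>e\<in>arcs G. voltage G f e * (?i e - ?i' e)) = 0"
    using sum_mult_flux[of f x] sum_mult_flux[of f x'] zero
    by (simp add: right_diff_distrib sum_subtractf)
  moreover have nonneg: "voltage G f e * (?i e - ?i' e) \<ge> 0" for e
    using current_mono[of x e x'] current_mono[of x' e x]
    by (cases "voltage G x e \<le> voltage G x' e")
       (auto simp: volt intro: mult_nonneg_nonneg mult_nonpos_nonpos)
  ultimately have "voltage G f e * (?i e - ?i' e) = 0" if "e \<in> arcs G" for e
    using that by (simp add: sum_nonneg_eq_0_iff)
  \<comment> \<open>A zero product means equal currents or equal voltages, and equal voltages give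
    equal currents.\<close>
  then have "?i e = ?i' e" if "e \<in> arcs G" for e
    using that by (fastforce simp: volt current_def)
  then show ?thesis
    unfolding total_current_def flux_def by (intro arg_cong2[of _ _ _ _ "(-)"] sum.cong) auto
qed

section \<open>Homogeneity in the boundary potentials\<close>

lemma flux_affine:
  assumes "c \<ge> 0"
  shows "flux G \<mu> r s (\<lambda>v. c * x v + d) v = c powr r * flux G \<mu> r s x v"
proof -
  have "voltage G (\<lambda>v. c * x v + d) e = c * voltage G x e" for e
    by (simp add: voltage_def algebra_simps)
  moreover have "max 0 (c * t) = c * max 0 t" for t
    using assms by (simp add: max_mult_distrib_left)
  ultimately have "current G \<mu> r s (\<lambda>v. c * x v + d) e = c powr r * current G \<mu> r s x e" for e
    using assms by (simp add: current_eq_max powr_mult)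
  then show ?thesis
    by (simp add: flux_def sum_distrib_left right_diff_distrib)
qed

text \<open>An affine image of the unit solution solves the general problem, and by uniqueness every
  other solution has the same total current.\<close>

lemma total_current_scale:
  assumes x1: "two_pole_solution G \<mu> r s a b 1 0 x1"
    and x: "two_pole_solution G \<mu> r s a b xa xb x" and "xb \<le> xa"
  shows "total_current G \<mu> r s a x = (xa - xb) powr r * total_current G \<mu> r s a x1"
proof -
  let ?z = "\<lambda>v. (xa - xb) * x1 v + xb"
  have "two_pole_solution G \<mu> r s a b xa xb ?z"
    using x1 \<open>xb \<le> xa\<close> by (simp add: two_pole_solution_def flux_affine)
  from total_current_unique[OF x this] show ?thesis
    using \<open>xb \<le> xa\<close> by (simp add: total_current_def flux_affine)
qed

section \<open>Positivity and reachability\<close>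

lemma awalk_potential_mono:
  fixes x :: "'a \<Rightarrow> real"
  assumes "awalk u p v" "\<And>e. e \<in> arcs G \<Longrightarrow> voltage G x e \<le> 0"
  shows "x u \<le> x v"
  using assms(1)
proof (induction p arbitrary: u)
  case (Cons e p)
  then have "x (head G e) \<le> x v" "e \<in> arcs G" "tail G e = u" by (auto simp: awalk_Cons_iff)
  then show ?case using assms(2)[of e] by (simp add: voltage_def)
qed (simp add: awalk_Nil_iff)

lemma total_current_pos:
  assumes "a \<in> verts G" and x: "two_pole_solution G \<mu> r s a b 1 0 x" and p: "awalk a p b"
  shows "total_current G \<mu> r s a x > 0"
proof -
  have "\<not> x a \<le> x b" using x by (simp add: two_pole_solution_def)
  with awalk_potential_mono[OF p] obtain e where e: "e \<in> arcs G" "voltage G x e > 0"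
    by (meson not_le)
  have nonneg: "voltage G x e * current G \<mu> r s x e \<ge> 0" for e
    using current_nonneg current_eq_0[of x e] by (cases "voltage G x e \<le> 0") auto
  have "(\<Sum>e\<in>arcs G. voltage G x e * current G \<mu> r s x e) > 0"
    using e current_pos[OF e] nonneg by (intro sum_pos2[of _ e]) auto
  also have "(\<Sum>e\<in>arcs G. voltage G x e * current G \<mu> r s x e)
      = (\<Sum>v\<in>verts G. x v * flux G \<mu> r s x v)"
    by (rule sum_mult_flux[symmetric])
  \<comment> \<open>Interior fluxes vanish, and the term at \<open>b\<close> drops out because its
    potential is 0.\<close>
  also have "\<dots> = (\<Sum>v\<in>{a}. x v * flux G \<mu> r s x v)"
    using assms by (intro sum.mono_neutral_right) (auto simp: two_pole_solution_def)
  finally show ?thesis using x by (simp add: two_pole_solution_def total_current_def)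
qed

lemma total_current_eq_0_if_unreachable:
  assumes "a \<in> verts G" "\<nexists>p. apath a p b" and x: "two_pole_solution G \<mu> r s a b xa xb x"
    and "xb \<le> xa"
  shows "total_current G \<mu> r s a x = 0"
proof -
  \<comment> \<open>A solution without currents: no edge leaves the set of nodes reachable from
    \<open>a\<close>, so no edge runs from potential \<open>xa\<close> down to
    \<open>xb\<close>.\<close>
  define z where "z v = (if a \<rightarrow>\<^sup>* v then xa else xb)" for v
  have za: "z a = xa" using \<open>a \<in> verts G\<close> by (simp add: z_def)
  have zb: "z b = xb" using assms(2) by (simp add: z_def reachable_apath)
  have "a \<rightarrow>\<^sup>* head G e" if "e \<in> arcs G" "a \<rightarrow>\<^sup>* tail G e" for e
    using that by (meson reachable_adj_trans in_arcs_imp_in_arcs_ends)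
  then have "voltage G z e \<le> 0" if "e \<in> arcs G" for e
    using that \<open>xb \<le> xa\<close> by (auto simp: voltage_def z_def)
  then have flux: "flux G \<mu> r s z v = 0" for v
    by (simp add: flux_def current_eq_0)
  then have "two_pole_solution G \<mu> r s a b xa xb z"
    using za zb by (simp add: two_pole_solution_def)
  from total_current_unique[OF x this] show ?thesis by (simp add: total_current_def flux)
qed

end

theorem mainTheorem3:
  fixes G :: "('a, 'b) pre_digraph" and \<mu> :: "'b \<Rightarrow> real" and r s :: real and a b :: 'a
  assumes "fin_digraph G"
    and "\<And>e. e \<in> arcs G \<Longrightarrow> \<mu> e > 0"
    and "r > 0" and "s > 0"
    and "a \<in> verts G" and "b \<in> verts G" and "a \<noteq> b"
  shows
    "(\<forall>xa xb. xa \<ge> xb \<longrightarrow>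
        (\<exists>x. two_pole_solution G \<mu> r s a b xa xb x) \<and>
        (\<forall>x x'. two_pole_solution G \<mu> r s a b xa xb x \<longrightarrow>
                two_pole_solution G \<mu> r s a b xa xb x' \<longrightarrow>
                total_current G \<mu> r s a x = total_current G \<mu> r s a x')) \<and>
     ((\<exists>p. pre_digraph.apath G a p b) \<longrightarrow>
        (\<exists>!\<mu>ab. \<mu>ab > 0 \<and>
           (\<forall>xa xb x. xa \<ge> xb \<longrightarrow> two_pole_solution G \<mu> r s a b xa xb x \<longrightarrow>
              total_current G \<mu> r s a x = (xa - xb) powr r / \<mu>ab powr s))) \<and>
     ((\<nexists>p. pre_digraph.apath G a p b) \<longrightarrow>
        (\<forall>xa xb x. xa \<ge> xb \<longrightarrow> two_pole_solution G \<mu> r s a b xa xb x \<longrightarrow>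
           total_current G \<mu> r s a x = 0))"
proof -
  interpret circuit G \<mu> r s
    using assms by (simp add: circuit_def circuit_axioms_def)
  have exist: "\<exists>x. two_pole_solution G \<mu> r s a b xa xb x" if "xb \<le> xa" for xa xb
    using that \<open>a \<noteq> b\<close> by (rule two_pole_solution_exists)
  obtain x1 where x1: "two_pole_solution G \<mu> r s a b 1 0 x1" using exist[of 0 1] by auto
  \<comment> \<open>The effective conductance: the current at unit voltage.\<close>
  define I where "I = total_current G \<mu> r s a x1"
  have scale: "total_current G \<mu> r s a x = (xa - xb) powr r * I"
    if "xa \<ge> xb" "two_pole_solution G \<mu> r s a b xa xb x" for xa xb x
    unfolding I_def using total_current_scale[OF x1 that(2,1)] .
  have "\<exists>!\<mu>ab. \<mu>ab > 0 \<and>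
           (\<forall>xa xb x. xa \<ge> xb \<longrightarrow> two_pole_solution G \<mu> r s a b xa xb x \<longrightarrow>
              total_current G \<mu> r s a x = (xa - xb) powr r / \<mu>ab powr s)"
    if "\<exists>p. apath a p b"
  proof -
    have I: "I > 0"
      unfolding I_def using that total_current_pos[OF \<open>a \<in> verts G\<close> x1] by (auto simp: apath_def)
    show ?thesis
    \<comment> \<open>The witness is the positive root of \<open>1 / m powr s = I\<close>.\<close>
    proof (rule ex1I[of _ "I powr (- 1 / s)"], intro conjI allI impI)
      show "I powr (- 1 / s) > 0" using I by simp
      have "(I powr (- 1 / s)) powr s = 1 / I"
        unfolding powr_powr using I \<open>s > 0\<close> by (simp add: powr_minus_divide)
      then show "total_current G \<mu> r s a x = (xa - xb) powr r / (I powr (- 1 / s)) powr s"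
        if "xa \<ge> xb" "two_pole_solution G \<mu> r s a b xa xb x" for xa xb x
        using scale[OF that] by simp
    next
      fix m
      assume m: "m > 0 \<and> (\<forall>xa xb x. xa \<ge> xb \<longrightarrow> two_pole_solution G \<mu> r s a b xa xb x \<longrightarrow>
              total_current G \<mu> r s a x = (xa - xb) powr r / m powr s)"
      \<comment> \<open>The boundary potentials 1 and 0 alone already determine
        \<open>m\<close>.\<close>
      then have "I = 1 powr r / m powr s"
        unfolding I_def using x1 by (metis diff_zero zero_le_one)
      then have "I = m powr (- s)" by (simp add: powr_minus_divide)
      then show "m = I powr (- 1 / s)" using m \<open>s > 0\<close> by (simp add: powr_powr)
    qed
  qed
  then show ?thesis
    using exist total_current_unique total_current_eq_0_if_unreachable[OF \<open>a \<in> verts G\<close>] by blast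
qed

end
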